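(* For every $\varepsilon > 0$ there exists a subset $A \subset \mathcal{P}$ of the set $\mathcal{P}$ of all primes with $\underline{\delta}(A) > 1-\varepsilon$ such that a positive proportion of the even positive integers cannot be written as $p_1+p_2$ with $p_1,p_2 \in A$.
   Context: $\mathcal{P}$ denotes the set of all primes. For $A \subset \mathcal{P}$, the relative lower density of $A$ in $\mathcal{P}$ is $$\underline{\delta}(A) = \liminf_{N\to\infty} \frac{|A\cap[1,N]|}{|\mathcal{P}\cap[1,N]|}.$$ The primes $p_1,p_2$ are not required to be distinct. "A positive proportion of the even positive integers" have a property means that the set $S$ of even positive integers with that property satisfies $\liminf_{X\to\infty} |S\cap[1,X]|/X > 0$. *)

theory Defs
  imports "HOL-Library.Liminf_Limsup" "HOL-Library.Extended_Real" "HOL-Computational_Algebra.Primes"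
begin

(* The lower limits are taken in ereal, where they always exist.  A quotient with an
   empty denominator (finitely many N) is 0 by convention and does not affect them. *)

definition lower_prime_density :: "nat set \<Rightarrow> ereal" where
  "lower_prime_density A =
     liminf (\<lambda>N. ereal (real (card (A \<inter> {1..N})) / real (card ({p. prime p} \<inter> {1..N}))))"

definition lower_density :: "nat set \<Rightarrow> ereal" where
  "lower_density S = liminf (\<lambda>X. ereal (real (card (S \<inter> {1..X})) / real X))"

end

(* Fix q = N!, with N so large that phi(q)/q <= 1/harm N is tiny compared with epsilon. In every block
   4^k < p <= 4^(k+1), averaging over the even residues b modulo q gives some b(k) for which only a
   fraction <= 2 phi(q)/q of the primes p of the block have p + b(k) coprime to q. The set A arises by
   removing these primes from every block, together with the prime divisors of q. By the Chebyshev-type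
   bound pi(2n) <= 7 pi(n), the removed primes have small upper relative density.

   Let 2 * 4^k < n <= 4^(k+1) and n + b(k) = 0 modulo q. In a representation n = p1 + p2 with p1 >= p2
   in A, the prime p1 lies in the k-th block and p1 + b(k) = -p2 is a unit modulo q, so p1 was removed:
   a contradiction. These n are even and have positive lower density.

   The Chebyshev-type bound compares two estimates: the product of the primes in (n, 2n] divides
   (2n choose n) <= 4^n, whereas m (2m choose m), which is at least 4^m / 2, divides a common multiple
   of 1, ..., 2m of size at most (2m)^pi(2m). *)

theory Submission
  imports Defs "HOL-Number_Theory.Totient" "HOL-Analysis.Harmonic_Numbers"
begin

section \<open>A Chebyshev-type doubling bound for the prime-counting function pi\<close>

definition primes_le :: "nat \<Rightarrow> nat set" where
  "primes_le n = {p. prime p \<and> p \<le> n}"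

lemma finite_primes_le [simp]: "finite (primes_le n)"
  by (rule finite_subset[of _ "{..n}"]) (auto simp: primes_le_def)

lemma primes_le_mono: "m \<le> n \<Longrightarrow> primes_le m \<subseteq> primes_le n"
  by (auto simp: primes_le_def)

lemma card_primes_le_mono: "m \<le> n \<Longrightarrow> card (primes_le m) \<le> card (primes_le n)"
  by (intro card_mono primes_le_mono) auto

text \<open>The recursion \<open>1/(k C(n,k)) = 1/(k C(n-1,k)) - 1/((k+1) C(n,k+1))\<close> of Leibniz's harmonic triangle.\<close>

lemma divide_binomial_in_Ints:
  fixes M :: nat
  assumes dvd: "\<And>i. 1 \<le> i \<Longrightarrow> i \<le> n \<Longrightarrow> i dvd M"
  shows "1 \<le> k \<Longrightarrow> k + d \<le> n \<Longrightarrow> real M / (real k * real ((k + d) choose k)) \<in> \<int>"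
proof (induction d arbitrary: k)
  case 0
  then have "k dvd M" using dvd by auto
  then show ?case using 0 by (auto elim!: dvdE)
next
  case (Suc d)
  let ?a = "(k + d) choose k" and ?b = "(k + Suc d) choose k"
  have 1: "real M / (real k * real ?a) \<in> \<int>"
    using Suc.IH[of k] Suc.prems by auto
  \<comment> \<open>Absorption rewrites the neighbouring entry of the triangle so that both terms of
    the difference contain the same binomial coefficient \<open>?a\<close>.\<close>
  have "Suc k * ((Suc k + d) choose Suc k) = (k + Suc d) * ?a"
    using Suc_times_binomial_eq[of "k + d" k] by (simp add: mult.commute)
  then have 2: "real M / (real (k + Suc d) * real ?a) \<in> \<int>"
    using Suc.IH[of "Suc k"] Suc.prems by (metis add_Suc_shift le_add1 of_nat_mult plus_1_eq_Suc)
  have "Suc d * ?b = (k + Suc d) * ?a"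
    using binomial_absorb_comp[of "k + Suc d" k] by simp
  then have e: "real (Suc d) * real ?b = real (k + Suc d) * real ?a"
    by (metis of_nat_mult)
  have "real ?a > 0" "real ?b > 0" by simp_all
  then have "real M / (real k * real ?b)
      = real M * real (Suc d) / (real k * (real (Suc d) * real ?b))"
    by simp
  also have "\<dots> = real M / (real k * real ?a) - real M / (real (k + Suc d) * real ?a)"
  proof -
    have "x * (y - z) / (z * (y * a)) = x / (z * a) - x / (y * a)"
      if "y > 0" "z > 0" "a > 0" for x y z a :: real
      using that by (simp add: field_simps)
    from this[of "real (k + Suc d)" "real k" "real ?a" "real M"] show ?thesis
      unfolding e using Suc.prems \<open>real ?a > 0\<close> by simp
  qed
  finally show ?case using Ints_diff[OF 1 2] by simp
qed

text \<open>Integrality of the quotient is divisibility. With k = m and n = 2m, every positive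
  common multiple of 1, ..., 2m is therefore at least m C(2m, m).\<close>

lemma mult_binomial_dvd:
  fixes M :: nat
  assumes "\<And>i. 1 \<le> i \<Longrightarrow> i \<le> n \<Longrightarrow> i dvd M" "1 \<le> k" "k \<le> n"
  shows "k * (n choose k) dvd M"
proof -
  have "real M / (real k * real (n choose k)) \<in> \<int>"
    using divide_binomial_in_Ints[of n M k "n - k"] assms by simp
  then obtain z where z: "real M / real (k * (n choose k)) = of_int z"
    by (auto elim!: Ints_cases)
  have pos: "k * (n choose k) > 0" using assms by simp
  with z have "real M = of_int z * real (k * (n choose k))" by (simp add: field_simps)
  then have "int M = z * int (k * (n choose k))"
    by (metis of_int_eq_iff of_int_mult of_int_of_nat_eq)
  then have "int (k * (n choose k)) dvd int M" by simp
  then show ?thesis by (simp only: of_nat_dvd_iff)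
qed

text \<open>The witness is the least common multiple: the product over the primes p up to n of the
  largest power of p not exceeding n, so that each factor is at most n.\<close>

lemma common_multiple_le_power_card_primes:
  assumes "n \<ge> 1"
  obtains M :: nat where "M > 0" "\<And>i. 1 \<le> i \<Longrightarrow> i \<le> n \<Longrightarrow> i dvd M" "M \<le> n ^ card (primes_le n)"
proof -
  define f where "f p = (GREATEST e. p ^ e \<le> n)" for p :: nat
  define M where "M = (\<Prod>p\<in>primes_le n. p ^ f p)"
  \<comment> \<open>Bounded exponents ensure that \<open>GREATEST\<close> denotes an actual
    maximum.\<close>
  have bound: "e \<le> n" if "p ^ e \<le> n" "prime p" for p e :: nat
  proof -
    have "e < 2 ^ e" by simp
    also have "\<dots> \<le> p ^ e" using that prime_ge_2_nat by (intro power_mono) auto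
    finally show ?thesis using that by simp
  qed
  have f1: "p ^ f p \<le> n" if "prime p" for p
    unfolding f_def by (rule GreatestI_nat[of _ 0 n]) (use assms bound that in auto)
  have f2: "e \<le> f p" if "p ^ e \<le> n" "prime p" for p e
    unfolding f_def by (rule Greatest_le_nat[of _ _ n]) (use assms bound that in auto)
  have pos: "M > 0" unfolding M_def
    by (rule prod_pos) (auto simp: primes_le_def prime_gt_0_nat)
  moreover have "i dvd M" if i: "1 \<le> i" "i \<le> n" for i
  proof (rule multiplicity_le_imp_dvd)
    fix p :: nat assume p: "prime p"
    have "p ^ multiplicity p i dvd i" by (rule multiplicity_dvd)
    then have le: "p ^ multiplicity p i \<le> n" using i dvd_imp_le[of _ i] by fastforce
    show "multiplicity p i \<le> multiplicity p M"
    proof (cases "p \<le> n")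
      case True
      then have "multiplicity p M = f p" unfolding M_def
        using p by (subst multiplicity_prod_prime_powers) (auto simp: primes_le_def)
      then show ?thesis using f2[OF le p] by simp
    next
      case False
      then have "\<not> p dvd i" using i by (auto dest: dvd_imp_le)
      then show ?thesis by (simp add: not_dvd_imp_multiplicity_0)
    qed
  qed (use i in auto)
  moreover have "M \<le> n ^ card (primes_le n)"
    unfolding M_def by (rule prod_le_power) (use assms in \<open>auto simp: primes_le_def f1\<close>)
  ultimately show ?thesis by (rule that)
qed

text \<open>The lower estimate for pi; in logarithmic form, pi(2m) log(2m) >= (2m - 1) log
  2.\<close>

lemma four_power_le_power_card_primes:
  assumes "m \<ge> 1"
  shows "4 ^ m \<le> 2 * (2 * m) ^ card (primes_le (2 * m))"
proof -
  obtain M where M: "M > 0" "\<And>i. 1 \<le> i \<Longrightarrow> i \<le> 2 * m \<Longrightarrow> i dvd M"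
    "M \<le> (2 * m) ^ card (primes_le (2 * m))"
    using common_multiple_le_power_card_primes[of "2 * m"] assms by auto
  have "real (4 ^ m) \<le> real (2 * (m * ((2 * m) choose m)))"
    using central_binomial_lower_bound[of m] assms by (simp add: field_simps)
  then have "4 ^ m \<le> 2 * (m * ((2 * m) choose m))" by (simp only: of_nat_le_iff)
  also have "m * ((2 * m) choose m) \<le> M"
    using mult_binomial_dvd[of "2 * m" M m] M assms by (intro dvd_imp_le) auto
  finally show ?thesis using M(3) by simp
qed

lemma prod_primes_dvd:
  fixes x :: nat
  assumes "finite P" "\<And>p. p \<in> P \<Longrightarrow> prime p \<and> p dvd x"
  shows "\<Prod>P dvd x"
  using assms
proof (induction P rule: finite_induct)
  case (insert p P)
  have "coprime p (\<Prod>P)"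
    using insert by (intro prod_coprime_right) (auto intro!: primes_coprime)
  then show ?case using insert by (simp add: divides_mult)
qed simp

text \<open>The upper estimate. A prime in (n, 2n] divides (2n)! but not n!, hence it divides C(2n,
  n); each such prime exceeds n.\<close>

lemma power_card_primes_diff_le:
  "n ^ (card (primes_le (2 * n)) - card (primes_le n)) \<le> 4 ^ n"
proof -
  let ?P = "primes_le (2 * n) - primes_le n"
  have "n ^ card ?P \<le> \<Prod>?P"
  proof -
    have "(\<Prod>p\<in>?P. n) \<le> \<Prod>?P" by (rule prod_mono) (auto simp: primes_le_def)
    then show ?thesis by simp
  qed
  also have "\<Prod>?P dvd ((2 * n) choose n)"
  proof (rule prod_primes_dvd)
    fix p assume "p \<in> ?P"
    then have p: "prime p" "n < p" "p \<le> 2 * n" by (auto simp: primes_le_def)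
    have "fact (2 * n) = fact n * fact n * ((2 * n) choose n)"
      using binomial_fact_lemma[of n "2 * n"] by simp
    moreover have "p dvd fact (2 * n)" "\<not> p dvd fact n"
      using p by (auto simp: prime_dvd_fact_iff)
    ultimately show "prime p \<and> p dvd ((2 * n) choose n)"
      using p by (metis prime_dvd_mult_iff)
  qed simp
  then have "\<Prod>?P \<le> ((2 * n) choose n)" by (rule dvd_imp_le) simp
  also have "\<dots> \<le> 4 ^ n" using binomial_le_pow2[of "2 * n" n] by (simp add: power_mult)
  finally show ?thesis by (simp add: card_Diff_subset primes_le_mono)
qed

text \<open>Both estimates concern powers of n, and comparing exponents gives pi(2n) - pi(n) <= 4 +
  2 pi(n). The 4 is at most 4 pi(n), whence the factor 7.\<close>

lemma card_primes_le_double: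
  assumes "n \<ge> 2"
  shows "card (primes_le (2 * n)) \<le> 7 * card (primes_le n)"
proof -
  define m where "m = n div 2"
  let ?a = "card (primes_le n)"
  have m: "m \<ge> 1" "n \<le> 2 * m + 1" "2 * m \<le> n" using assms by (auto simp: m_def)
  have "(2 * m) ^ card (primes_le (2 * m)) \<le> n ^ card (primes_le (2 * m))"
    using m by (intro power_mono) auto
  also have "\<dots> \<le> n ^ ?a" using m by (intro power_increasing card_primes_le_mono) auto
  finally have "4 ^ m \<le> 2 * n ^ ?a" using four_power_le_power_card_primes[of m] m by linarith
  \<comment> \<open>Since m is about n / 2, squaring reaches 4^(2m), which falls short of 4^n by at
    most a factor 4.\<close>
  then have "(4 ^ m) ^ 2 \<le> (2 * n ^ ?a) ^ 2" by (rule power_mono) simp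
  then have 1: "4 ^ (2 * m) \<le> 4 * n ^ (2 * ?a)"
    by (simp add: power_mult_distrib power_mult [symmetric] mult.commute)
  have "n ^ (card (primes_le (2 * n)) - ?a) \<le> 4 ^ n" by (rule power_card_primes_diff_le)
  also have "\<dots> \<le> 4 ^ (2 * m + 1)" using m by (intro power_increasing) auto
  also have "\<dots> \<le> 2 ^ 4 * n ^ (2 * ?a)" using 1 by simp
  \<comment> \<open>The constant 16 is absorbed into n^4, so that only exponents to base n
    remain.\<close>
  also have "\<dots> \<le> n ^ 4 * n ^ (2 * ?a)" using assms by (intro mult_right_mono power_mono) auto
  also have "\<dots> = n ^ (4 + 2 * ?a)" by (simp add: power_add)
  finally have "card (primes_le (2 * n)) - ?a \<le> 4 + 2 * ?a"
    using assms by (simp add: power_increasing_iff)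
  moreover have "2 \<in> primes_le n" using assms by (simp add: primes_le_def two_is_prime_nat)
  then have "?a \<ge> 1" by (metis card_0_eq empty_iff finite_primes_le less_one not_le)
  ultimately show ?thesis by linarith
qed

section \<open>Units modulo q: periodicity, the totient of a factorial, averaging over
  shifts\<close>

text \<open>Moving the window by one replaces \<open>c\<close> by \<open>c + q\<close>, and both are
  coprime to \<open>q\<close> or neither is.\<close>

lemma card_coprime_interval:
  "card {m \<in> {c..<c + q}. coprime m q} = totient q"
proof (induction c)
  case 0
  show ?case
  \<comment> \<open>The window starts at 0, totatives at 1; the two sets of units differ only for q
    = 1, where they are {0} and {1}.\<close>
  proof (cases "q \<le> 1")
    case True
    then consider "q = 0" | "q = 1" by linarith
    then show ?thesis
    proof cases
      case 2
      then have "{m \<in> {0..<0 + q}. coprime m q} = {0}" by auto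
      with 2 show ?thesis by simp
    qed simp
  next
    case False
    have "{m \<in> {0..<0 + q}. coprime m q} = totatives q"
    proof (intro equalityI subsetI)
      fix m assume "m \<in> {m \<in> {0..<0 + q}. coprime m q}"
      then show "m \<in> totatives q" using False by (cases "m = 0") (auto simp: in_totatives_iff)
    next
      fix m assume "m \<in> totatives q"
      then show "m \<in> {m \<in> {0..<0 + q}. coprime m q}"
        using False totatives_less[of m q] by (auto simp: in_totatives_iff)
    qed
    then show ?thesis by (simp add: totient_def)
  qed
next
  case (Suc c)
  show ?case
  proof (cases "q = 0")
    case False
    let ?S = "{m \<in> {Suc c..<c + q}. coprime m q}"
    have "coprime (c + q) q \<longleftrightarrow> coprime c q" by (simp add: coprime_iff_gcd_eq_1)
    moreover have "{c..<c + q} = insert c {Suc c..<c + q}"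
      "{Suc c..<Suc c + q} = insert (c + q) {Suc c..<c + q}"
      using False by auto
    ultimately have
      "{m \<in> {c..<c + q}. coprime m q} = (if coprime c q then insert c ?S else ?S)"
      "{m \<in> {Suc c..<Suc c + q}. coprime m q} = (if coprime c q then insert (c + q) ?S else ?S)"
      by (auto simp del: atLeastLessThan_iff)
    then show ?thesis using Suc.IH by (auto split: if_splits)
  qed simp
qed

lemma card_coprime_upto_mult:
  "card {m \<in> {0<..q * t}. coprime m q} = t * totient q"
proof (induction t)
  case (Suc t)
  let ?A = "{m \<in> {0<..q * t}. coprime m q}"
    and ?B = "{m \<in> {Suc (q * t)..<Suc (q * t) + q}. coprime m q}"
  have "{m \<in> {0<..q * Suc t}. coprime m q} = ?A \<union> ?B"
    by auto
  then have "card {m \<in> {0<..q * Suc t}. coprime m q} = card (?A \<union> ?B)"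
    by (rule arg_cong)
  also have "\<dots> = card ?A + card ?B"
    by (rule card_Un_disjoint) auto
  also have "\<dots> = Suc t * totient q"
    unfolding Suc.IH card_coprime_interval by simp
  finally show ?case .
qed simp

text \<open>For \<open>q = N!\<close>, the products \<open>d m\<close> with \<open>d \<le> N\<close> and \<open>m \<le> q\<^sup>2 / d\<close> coprime to \<open>q\<close> are pairwise
  distinct elements of \<open>{1..q\<^sup>2}\<close>, and there are \<open>(q / d) \<phi>(q)\<close> of them for each \<open>d\<close>.\<close>

lemma harm_totient_fact_le: "harm N * real (totient (fact N)) \<le> fact N"
proof -
  define q :: nat where "q = fact N"
  have q: "q > 0" by (simp add: q_def)
  have dvd: "d dvd q" if "d \<in> {1..N}" for d using that by (simp add: q_def dvd_fact)
  define S where "S d = {m \<in> {0<..q * (q div d)}. coprime m q}" for d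
  have "inj_on (\<lambda>(d, m). d * m) (Sigma {1..N} S)"
  proof (rule inj_onI, clarify)
    fix d m d' m' assume a: "d \<in> {1..N}" "m \<in> S d" "d' \<in> {1..N}" "m' \<in> S d'" "d * m = d' * m'"
    \<comment> \<open>Both \<open>d\<close> and \<open>d'\<close> divide \<open>q\<close>, to which
      \<open>m\<close> and \<open>m'\<close> are coprime; hence the equation d m = d' m' makes
      \<open>d\<close> and \<open>d'\<close> divide each other.\<close>
    have "coprime d m'" "coprime d' m"
      using a dvd[of d] dvd[of d'] coprime_divisors[of d q m' m'] coprime_divisors[of d' q m m]
      by (simp_all add: S_def coprime_commute)
    then have "d dvd d'" "d' dvd d"
      using a(5) by (metis coprime_dvd_mult_left_iff dvd_triv_left, metis coprime_dvd_mult_left_iff dvd_triv_left)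
    then have "d = d'" by (rule dvd_antisym)
    then show "d = d' \<and> m = m'" using a by simp
  qed
  moreover have "(\<lambda>(d, m). d * m) ` Sigma {1..N} S \<subseteq> {0<..q * q}"
  proof clarify
    fix d m assume a: "d \<in> {1..N}" "m \<in> S d"
    then have "d * m \<le> d * (q * (q div d))" by (auto simp: S_def)
    also have "\<dots> = q * q" using dvd[OF a(1)] by simp
    finally show "d * m \<in> {0<..q * q}" using a by (auto simp: S_def)
  qed
  ultimately have "card (Sigma {1..N} S) \<le> q * q"
    using card_inj_on_le[of _ "Sigma {1..N} S" "{0<..q * q}"] by simp
  also have "card (Sigma {1..N} S) = (\<Sum>d=1..N. card (S d))"
    by (rule card_SigmaI) (auto simp: S_def)
  also have "\<dots> = (\<Sum>d=1..N. (q div d) * totient q)"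
    unfolding S_def card_coprime_upto_mult ..
  finally have "real (\<Sum>d=1..N. (q div d) * totient q) \<le> real (q * q)" by (simp only: of_nat_le_iff)
  also have "real (\<Sum>d=1..N. (q div d) * totient q) = (\<Sum>d=1..N. real q * (inverse (real d) * real (totient q)))"
    unfolding of_nat_sum by (rule sum.cong) (use dvd in \<open>auto simp: real_of_nat_div field_simps\<close>)
  also have "\<dots> = real q * (harm N * real (totient q))"
    by (simp add: harm_def sum_distrib_left sum_distrib_right)
  finally have "harm N * real (totient q) \<le> real q" using q by simp
  then show ?thesis by (simp add: q_def)
qed

text \<open>Averaging over the even residues \<open>b\<close> replaces equidistribution of primes in progressions.\<close>

lemma exists_even_shift_few_coprime:
  fixes B :: "nat set"
  assumes "finite B" "even q" "q > 0"
  shows "\<exists>b. even b \<and> q * card {p \<in> B. coprime (p + b) q} \<le> 2 * totient q * card B"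
proof (rule ccontr)
  assume contra: "\<not> ?thesis"
  let ?E = "{b \<in> {0..<q}. even b}"
  let ?f = "\<lambda>b. card {p \<in> B. coprime (p + b) q}"
  have "bij_betw (\<lambda>i. 2 * i) {0..<q div 2} ?E"
    by (rule bij_betwI[where g = "\<lambda>b. b div 2"]) (use \<open>even q\<close> in \<open>auto elim!: evenE\<close>)
  then have "card ?E = q div 2"
    by (metis bij_betw_same_card card_atLeastLessThan diff_zero)
  then have cardE: "2 * card ?E = q" using \<open>even q\<close> by simp
  \<comment> \<open>For each fixed p, the sum p + b over all residues b meets every class once,
    which gives the total exactly. It is shared among only q / 2 even residues, whence the factor
    2.\<close>
  have "(\<Sum>b\<in>?E. ?f b) \<le> (\<Sum>b\<in>{0..<q}. ?f b)"
    by (rule sum_mono2) auto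
  also have "\<dots> = (\<Sum>b\<in>{0..<q}. \<Sum>p\<in>B. if coprime (p + b) q then 1 else 0)"
    using \<open>finite B\<close> by (simp add: sum.If_cases Int_def)
  also have "\<dots> = (\<Sum>p\<in>B. \<Sum>b\<in>{0..<q}. if coprime (p + b) q then 1 else 0)"
    by (rule sum.swap)
  also have "\<dots> = (\<Sum>p\<in>B. card {b \<in> {0..<q}. coprime (p + b) q})"
    by (simp add: sum.If_cases Int_def)
  also have "\<dots> = (\<Sum>p\<in>B. totient q)"
  proof (rule sum.cong)
    fix p assume "p \<in> B"
    have "bij_betw (\<lambda>b. p + b) {b \<in> {0..<q}. coprime (p + b) q} {m \<in> {p..<p + q}. coprime m q}"
      by (rule bij_betwI[where g = "\<lambda>m. m - p"]) auto
    from bij_betw_same_card[OF this] show "card {b \<in> {0..<q}. coprime (p + b) q} = totient q"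
      by (simp only: card_coprime_interval)
  qed simp
  finally have le: "(\<Sum>b\<in>?E. ?f b) \<le> card B * totient q" by simp
  have "?E \<noteq> {}" using assms by auto
  then have "(\<Sum>b\<in>?E. 2 * totient q * card B) < (\<Sum>b\<in>?E. q * ?f b)"
    using contra by (intro sum_strict_mono) (auto simp: not_le)
  also have "\<dots> = q * (\<Sum>b\<in>?E. ?f b)" by (simp add: sum_distrib_left)
  also have "\<dots> \<le> q * (card B * totient q)" using le by (rule mult_left_mono) simp
  also have "\<dots> = (2 * card ?E) * (card B * totient q)" using cardE by simp
  finally show False by (simp add: mult.assoc mult.left_commute)
qed

section \<open>Criteria for lower bounds on the two densities\<close>

text \<open>The counted numbers correspond to the multiples of q in (M + b, 2M + b], and integer
  division is superadditive.\<close>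

lemma card_congruent_in_interval_ge:
  assumes "q > 0"
  shows "M div q \<le> card {n \<in> {M<..2 * M}. q dvd n + b}"
proof -
  let ?T = "{(M + b) div q<..(2 * M + b) div q}"
  have "M div q + (M + b) div q \<le> (2 * M + b) div q"
    using div_add1_eq[of M "M + b" q] by (simp add: mult_2 add.assoc)
  then have "M div q \<le> card ?T" by simp
  also have "card ?T \<le> card {n \<in> {M<..2 * M}. q dvd n + b}"
  proof (rule card_inj_on_le[of "\<lambda>t. q * t - b"])
    \<comment> \<open>In particular b < q t, so the truncated subtraction of b is exact.\<close>
    have range: "M + b < q * t \<and> q * t \<le> 2 * M + b" if "t \<in> ?T" for t
      using that assms by (simp add: div_less_iff_less_mult less_eq_div_iff_mult_less_eq mult.commute)
    show "inj_on (\<lambda>t. q * t - b) ?T"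
    proof (rule inj_onI)
      fix s t assume "s \<in> ?T" "t \<in> ?T" "q * s - b = q * t - b"
      then have "q * s = q * t" using range[of s] range[of t] by linarith
      then show "s = t" using assms by simp
    qed
    show "(\<lambda>t. q * t - b) ` ?T \<subseteq> {n \<in> {M<..2 * M}. q dvd n + b}"
      using range by fastforce
  qed simp
  finally show ?thesis .
qed

text \<open>For 4^(k+1) <= X < 4^(k+2), the single range (2 * 4^k, 4^(k+1)] has length more than X /
  8 and already supplies enough elements. Hence the residue may change with k.\<close>

lemma lower_density_pos_if_dyadic:
  assumes "q > 0"
    and S: "\<And>k n. 2 * 4 ^ k < n \<Longrightarrow> n \<le> 4 ^ Suc k \<Longrightarrow> q dvd n + b k \<Longrightarrow> n \<in> S"
  shows "lower_density S > 0"
proof -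
  have "1 / (16 * real q) \<le> real (card (S \<inter> {1..X})) / real X" if X: "X \<ge> 16 * q" for X
  proof -
    have "X \<ge> 4" using X assms by linarith
    then obtain K where K: "4 ^ K \<le> X" "X < 4 ^ (K + 1)"
      using ex_power_ivl1[of 4 X] by auto
    with \<open>X \<ge> 4\<close> obtain k where k: "K = Suc k"
      by (cases K) auto
    let ?M = "2 * 4 ^ k"
    have "?M div q \<le> card {n \<in> {?M<..2 * ?M}. q dvd n + b k}"
      by (rule card_congruent_in_interval_ge) fact
    also have "\<dots> \<le> card (S \<inter> {1..X})"
      by (rule card_mono) (use S[of k] K k in auto)
    finally have le: "?M div q \<le> card (S \<inter> {1..X})" .
    have "?M < q * Suc (?M div q)" using assms by (simp add: dividend_less_times_div)
    then have "X < 8 * (q * Suc (?M div q))" using K(2) k by simp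
    also have "\<dots> \<le> 8 * (q * Suc (card (S \<inter> {1..X})))" using le by simp
    \<comment> \<open>The rounding loss 8 q is at most X / 2.\<close>
    finally have "X \<le> 16 * q * card (S \<inter> {1..X})" using X by simp
    then have "real X \<le> 16 * real q * real (card (S \<inter> {1..X}))"
      by (metis of_nat_le_iff of_nat_mult of_nat_numeral)
    then show ?thesis using \<open>X \<ge> 4\<close> assms by (simp add: field_simps)
  qed
  then have "\<forall>\<^sub>F X in sequentially. ereal (1 / (16 * real q)) \<le> ereal (real (card (S \<inter> {1..X})) / real X)"
    unfolding eventually_sequentially by auto
  then have "ereal (1 / (16 * real q)) \<le> lower_density S"
    unfolding lower_density_def by (rule Liminf_bounded)
  then show ?thesis using assms by (auto elim: less_le_trans[rotated])
qed

lemma card_primes_le_at_top: "filterlim (\<lambda>N. card (primes_le N)) at_top sequentially"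
proof (subst filterlim_at_top, intro allI)
  fix c
  obtain P :: "nat set" where P: "P \<subseteq> {p. prime p}" "finite P" "card P = c"
    using infinite_arbitrarily_large[OF primes_infinite] by blast
  obtain m where "P \<subseteq> {..m}" using \<open>finite P\<close> finite_nat_iff_bounded_le by blast
  then have "c \<le> card (primes_le N)" if "N \<ge> m" for N
    using P that by (auto simp: primes_le_def intro!: card_mono[of "primes_le N", unfolded primes_le_def])
  then show "\<forall>\<^sub>F N in sequentially. c \<le> card (primes_le N)"
    unfolding eventually_sequentially by blast
qed

text \<open>Since pi tends to infinity, the additive constant \<open>C\<close> is negligible; it
  accommodates finitely many further removed primes. A value strictly between c and d keeps the
  inequality strict in the limit.\<close>

lemma lower_prime_density_gt:
  fixes c d :: real
  assumes "A \<subseteq> {p. prime p}" "c < d"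
    and rem: "\<And>N. N \<ge> N0 \<Longrightarrow>
      real (card (primes_le N - A)) \<le> (1 - d) * real (card (primes_le N)) + C"
  shows "lower_prime_density A > ereal c"
proof -
  define e where "e = (c + d) / 2"
  have e: "c < e" "e < d" using assms by (simp_all add: e_def)
  have "filterlim (\<lambda>N. real (card (primes_le N))) at_top sequentially"
    by (rule filterlim_compose[OF filterlim_real_sequentially card_primes_le_at_top])
  then have "\<forall>\<^sub>F N in sequentially. max 1 (C / (d - e)) \<le> real (card (primes_le N))"
    unfolding filterlim_at_top by blast
  moreover have "\<forall>\<^sub>F N in sequentially. N \<ge> N0" by (rule eventually_ge_at_top)
  ultimately have "\<forall>\<^sub>F N in sequentially.
      ereal e \<le> ereal (real (card (A \<inter> {1..N})) / real (card ({p. prime p} \<inter> {1..N})))"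
  proof eventually_elim
    case (elim N)
    let ?x = "real (card (primes_le N))"
    have eqs: "{p. prime p} \<inter> {1..N} = primes_le N" "A \<inter> {1..N} = primes_le N - (primes_le N - A)"
      using assms(1) by (auto simp: primes_le_def Suc_le_eq prime_gt_0_nat)
    have "real (card (A \<inter> {1..N})) = ?x - real (card (primes_le N - A))"
      unfolding eqs by (subst card_Diff_subset) (auto simp: of_nat_diff card_mono)
    moreover have "C \<le> (d - e) * ?x" using elim(1) e by (simp add: field_simps)
    ultimately have "e * ?x \<le> real (card (A \<inter> {1..N}))"
      using rem[OF elim(2)] by (simp add: algebra_simps)
    then show ?case using elim(1) unfolding eqs(1) by (simp add: field_simps)
  qed
  then have "ereal e \<le> lower_prime_density A"
    unfolding lower_prime_density_def by (rule Liminf_bounded)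
  then show ?thesis using e by (meson ereal_less_eq(3) less_ereal.simps(1) less_le_trans)
qed

section \<open>Blocks of primes and the construction of A\<close>

text \<open>Ratio 4 leaves room for halving: if 2 * 4^k < n <= 4^(k+1), the larger of two prime
  summands of n is at least n / 2 and stays in the block.\<close>

definition prime_block :: "nat \<Rightarrow> nat set" where
  "prime_block k = {p. prime p \<and> 4 ^ k < p \<and> p \<le> 4 ^ Suc k}"

lemma finite_prime_block [simp]: "finite (prime_block k)"
  by (rule finite_subset[of _ "{..4 ^ Suc k}"]) (auto simp: prime_block_def)

lemma sum_card_prime_block_le: "(\<Sum>j\<le>k. card (prime_block j)) \<le> card (primes_le (4 ^ Suc k))"
proof (induction k)
  case 0
  have "card (prime_block 0) \<le> card (primes_le (4 ^ Suc 0))"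
    by (rule card_mono) (auto simp: prime_block_def primes_le_def)
  then show ?case by simp
next
  case (Suc k)
  have "(\<Sum>j\<le>Suc k. card (prime_block j)) \<le> card (primes_le (4 ^ Suc k)) + card (prime_block (Suc k))"
    using Suc.IH by simp
  also have "\<dots> = card (primes_le (4 ^ Suc k) \<union> prime_block (Suc k))"
    by (rule card_Un_disjoint[symmetric]) (auto simp: prime_block_def primes_le_def)
  also have "\<dots> \<le> card (primes_le (4 ^ Suc (Suc k)))"
  proof (rule card_mono)
    have "(4::nat) ^ Suc k \<le> 4 ^ Suc (Suc k)" by simp
    then show "primes_le (4 ^ Suc k) \<union> prime_block (Suc k) \<subseteq> primes_le (4 ^ Suc (Suc k))"
      unfolding prime_block_def primes_le_def using le_trans by blast
  qed simp
  finally show ?case .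
qed

lemma coprime_shift_if_sum_congruent:
  fixes p\<^sub>1 p\<^sub>2 :: nat
  assumes "prime p\<^sub>2" "\<not> p\<^sub>2 dvd q" "q dvd p\<^sub>1 + p\<^sub>2 + b"
  shows "coprime (p\<^sub>1 + b) q"
proof (rule coprimeI)
  fix d assume d: "d dvd p\<^sub>1 + b" "d dvd q"
  then have "d dvd (p\<^sub>1 + b) + p\<^sub>2" using assms(3) by (metis add.assoc add.commute dvd_trans)
  then have "d dvd p\<^sub>2" using d(1) by (simp add: dvd_add_right_iff)
  moreover have "coprime p\<^sub>2 q" using assms by (simp add: prime_imp_coprime)
  ultimately show "is_unit d" using d(2) by (metis coprime_common_divisor)
qed

theorem theorem1p1:
  fixes \<epsilon> :: real
  assumes "\<epsilon> > 0"
  shows "\<exists>A \<subseteq> {p::nat. prime p}.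
           lower_prime_density A > ereal (1 - \<epsilon>) \<and>
           lower_density {n. n > 0 \<and> even n \<and> \<not> (\<exists>p\<^sub>1\<in>A. \<exists>p\<^sub>2\<in>A. n = p\<^sub>1 + p\<^sub>2)} > 0"
proof -
  \<comment> \<open>Here 200 = 2 * 100: the 2 comes from using even residues only, and each block
    then loses at most the share \<epsilon> / 100 of its primes.\<close>
  have "\<forall>\<^sub>F N in sequentially. 200 / \<epsilon> \<le> harm N"
    using harm_at_top by (simp add: filterlim_at_top)
  then have "\<forall>\<^sub>F N in sequentially. 200 / \<epsilon> \<le> harm N \<and> 2 \<le> N"
    using eventually_ge_at_top by (rule eventually_conj)
  then obtain N where N: "200 / \<epsilon> \<le> harm N" "2 \<le> N"
    by (auto dest: eventually_happens)
  define q :: nat where "q = fact N"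
  have q: "q > 0" "even q" using N by (simp_all add: q_def dvd_fact)
  have "200 / \<epsilon> * real (totient q) \<le> harm N * real (totient q)"
    using N(1) by (rule mult_right_mono) simp
  also have "\<dots> \<le> real q" using harm_totient_fact_le[of N] by (simp add: q_def)
  finally have tot: "200 * real (totient q) \<le> \<epsilon> * real q" using assms by (simp add: field_simps)

  define R where "R k b = {p \<in> prime_block k. coprime (p + b) q}" for k b
  have "\<exists>b. even b \<and> q * card (R k b) \<le> 2 * totient q * card (prime_block k)" for k
    unfolding R_def using q by (intro exists_even_shift_few_coprime) auto
  then obtain b where b: "\<And>k. even (b k)"
    "\<And>k. q * card (R k (b k)) \<le> 2 * totient q * card (prime_block k)"
    by metis
  have R: "100 * real (card (R k (b k))) \<le> \<epsilon> * real (card (prime_block k))" for k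
  proof -
    have "real (q * card (R k (b k))) \<le> real (2 * totient q * card (prime_block k))"
      using b(2) by (simp only: of_nat_le_iff)
    then have "real q * (100 * real (card (R k (b k)))) \<le> 200 * real (totient q) * real (card (prime_block k))"
      by simp
    also have "\<dots> \<le> (\<epsilon> * real q) * real (card (prime_block k))"
      using tot by (rule mult_right_mono) simp
    finally have "real q * (100 * real (card (R k (b k)))) \<le> real q * (\<epsilon> * real (card (prime_block k)))"
      by (simp add: mult_ac)
    then show ?thesis using q by simp
  qed

  \<comment> \<open>Dropping the finitely many prime divisors of \<open>q\<close> makes every
    element of \<open>A\<close> a unit modulo \<open>q\<close>.\<close>
  define A where "A = {p. prime p \<and> \<not> p dvd q} - (\<Union>k. R k (b k))"
  have "A \<subseteq> {p. prime p}" by (auto simp: A_def)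
  moreover have "lower_prime_density A > ereal (1 - \<epsilon>)"
  proof (rule lower_prime_density_gt)
    show "A \<subseteq> {p. prime p}" by fact
    show "1 - \<epsilon> < 1 - \<epsilon> * 49 / 100" using assms by simp
    fix M :: nat assume M: "M \<ge> 2"
    then obtain k where k: "4 ^ k \<le> M" "M < 4 ^ Suc k"
      using ex_power_ivl1[of 4 M] by auto
    have "primes_le M - A \<subseteq> {p. p dvd q} \<union> (\<Union>j\<le>k. R j (b j))"
    proof
      fix p assume p: "p \<in> primes_le M - A"
      show "p \<in> {p. p dvd q} \<union> (\<Union>j\<le>k. R j (b j))"
      proof (cases "p dvd q")
        case False
        then obtain j where j: "p \<in> R j (b j)" using p by (auto simp: A_def primes_le_def)
        then have "4 ^ j < p" "p \<le> M" using p by (auto simp: R_def prime_block_def primes_le_def)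
        then have "(4::nat) ^ j < 4 ^ Suc k" using k by linarith
        then have "j \<le> k" using power_less_imp_less_exp[of "4::nat" j "Suc k"] by simp
        then show ?thesis using j by blast
      qed simp
    qed
    then have "card (primes_le M - A) \<le> card ({p. p dvd q} \<union> (\<Union>j\<le>k. R j (b j)))"
      using q by (intro card_mono) (auto simp: R_def)
    also have "\<dots> \<le> card {p. p dvd q} + card (\<Union>j\<le>k. R j (b j))" by (rule card_Un_le)
    also have "card (\<Union>j\<le>k. R j (b j)) \<le> (\<Sum>j\<le>k. card (R j (b j)))" by (rule card_UN_le) simp
    finally have "real (card (primes_le M - A)) \<le> real (card {p. p dvd q}) + (\<Sum>j\<le>k. real (card (R j (b j))))"
      by (simp only: of_nat_le_iff flip: of_nat_add of_nat_sum)
    also have "(\<Sum>j\<le>k. real (card (R j (b j)))) \<le> (\<Sum>j\<le>k. \<epsilon> / 100 * real (card (prime_block j)))"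
      using R by (intro sum_mono) (simp add: field_simps)
    also have "\<dots> = \<epsilon> / 100 * real (\<Sum>j\<le>k. card (prime_block j))" by (simp add: sum_distrib_left)
    also have "real (\<Sum>j\<le>k. card (prime_block j)) \<le> 49 * real (card (primes_le M))"
    proof -
      \<comment> \<open>The last block may reach beyond M, but only up to 4^(k+1) <= 4 M; two
        doublings lead back to M at the cost of the factor 49 = 7 * 7.\<close>
      have "(\<Sum>j\<le>k. card (prime_block j)) \<le> card (primes_le (4 ^ Suc k))"
        by (rule sum_card_prime_block_le)
      also have "\<dots> \<le> card (primes_le (2 * (2 * M)))" using k by (intro card_primes_le_mono) simp
      also have "\<dots> \<le> 7 * card (primes_le (2 * M))" using M by (intro card_primes_le_double) simp
      also have "\<dots> \<le> 7 * (7 * card (primes_le M))"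
        using M by (intro mult_left_mono card_primes_le_double) simp_all
      also have "\<dots> = 49 * card (primes_le M)" by simp
      finally have "real (\<Sum>j\<le>k. card (prime_block j)) \<le> real (49 * card (primes_le M))"
        by (simp only: of_nat_le_iff)
      then show ?thesis by (simp only: of_nat_mult of_nat_numeral)
    qed
    then have "\<epsilon> / 100 * real (\<Sum>j\<le>k. card (prime_block j)) \<le> \<epsilon> / 100 * (49 * real (card (primes_le M)))"
      using assms by (intro mult_left_mono) auto
    finally show "real (card (primes_le M - A)) \<le>
        (1 - (1 - \<epsilon> * 49 / 100)) * real (card (primes_le M)) + real (card {p. p dvd q})"
      by simp
  qed
  moreover have "lower_density {n. n > 0 \<and> even n \<and> \<not> (\<exists>p\<^sub>1\<in>A. \<exists>p\<^sub>2\<in>A. n = p\<^sub>1 + p\<^sub>2)} > 0"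
  proof (rule lower_density_pos_if_dyadic)
    show "q > 0" by fact
    fix k n :: nat assume n: "2 * 4 ^ k < n" "n \<le> 4 ^ Suc k" "q dvd n + b k"
    have "even n" using n(3) q(2) b(1)[of k] by (metis dvd_trans even_add)
    moreover have False if "p\<^sub>1 \<in> A" "p\<^sub>2 \<in> A" "n = p\<^sub>1 + p\<^sub>2" "p\<^sub>2 \<le> p\<^sub>1" for p\<^sub>1 p\<^sub>2
    proof -
      have "p\<^sub>1 \<in> prime_block k"
        using that n by (auto simp: prime_block_def A_def)
      moreover have "coprime (p\<^sub>1 + b k) q"
        using that n(3) by (intro coprime_shift_if_sum_congruent[of p\<^sub>2]) (auto simp: A_def)
      ultimately show False using that by (auto simp: A_def R_def)
    qed
    then have "\<not> (\<exists>p\<^sub>1\<in>A. \<exists>p\<^sub>2\<in>A. n = p\<^sub>1 + p\<^sub>2)"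
      by (metis add.commute linear)
    ultimately show "n \<in> {n. n > 0 \<and> even n \<and> \<not> (\<exists>p\<^sub>1\<in>A. \<exists>p\<^sub>2\<in>A. n = p\<^sub>1 + p\<^sub>2)}"
      using n(1) by simp
  qed
  ultimately show ?thesis by blast
qed

end
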